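(* Let $G$ be a ribbon graph with a proper ribbon $e$, and for even $n$ let $G+\sum_{i=1}^{n}e_i$ be the ribbon graph obtained from $G$ by adding $n$ ribbons $e_1,e_2,\dots,e_n$ parallel to $e$. Then, for all sufficiently large even $n$, the restricted-orientable partial-$\times$ polynomial of $G+\sum_{i=1}^{n}e_i$ is not even-interpolating.
   Context: A ribbon graph $G$ is a (possibly non-orientable) surface with boundary presented as a union of vertex discs and edge ribbons; $E(G)$ is its set of edges (ribbons), and $v(G)$, $e(G)$, $f(G)$, $c(G)$ are its numbers of vertices, edges, faces (boundary components) and connected components. The Euler genus is $\gamma(G)=2c(G)-v(G)+e(G)-f(G)$. For $A\subseteq E(G)$, the partial Petrial $G^{\times|_A}$ is the ribbon graph obtained from $G$ by adding a half-twist to each ribbon in $A$. The restricted-orientable partial-$\times$ polynomial of $G$ is $\sum_{A} z^{\gamma(G^{\times|_A})}$, where the sum is over all $A\subseteq E(G)$ such that $G^{\times|_A}$ is orientable. A proper ribbon is a ribbon with two different end vertices. Adding $n$ ribbons $e_1,\dots,e_n$ parallel to $e$ means adding new ribbons with the same end vertices as $e$, placed consecutively next to $e$ at both ends, so that in the sequence $e,e_1,\dots,e_n$ each two consecutive ribbons bound a face of length two (a bigon). The support of $f(z)=\sum_{i} a_i z^i$ is $\{i : a_i\neq 0\}$; a polynomial is even-interpolating if its support is the set of all even natural numbers in some integer interval $[m,m']$. *)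

theory Defs
  imports Main "HOL-Computational_Algebra.Polynomial"
begin

text \<open>
  Ribbon graphs are encoded as signed rotation systems.  A ribbon \<open>e\<close> has the two ends
  \<open>(e, False)\<close> and \<open>(e, True)\<close>.  Every vertex disc carries a reference orientation, and
  \<open>rot G v\<close> lists, up to cyclic rotation, the ribbon ends attached to the disc \<open>v\<close> in the order
  in which they are met along its boundary; it is empty for an isolated vertex.
  \<open>twisted G\<close> consists of the ribbons that carry a half-twist relative to the reference
  orientations of their end vertices.
\<close>

type_synonym 'e ribbon_end = "'e \<times> bool"

record ('v, 'e) ribbon_graph =
  verts :: "'v set"
  edges :: "'e set"
  rot :: "'v \<Rightarrow> 'e ribbon_end list"
  twisted :: "'e set"

definition is_ribbon_graph :: "('v, 'e) ribbon_graph \<Rightarrow> bool" where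
  "is_ribbon_graph G \<longleftrightarrow>
     finite (verts G) \<and> finite (edges G) \<and> twisted G \<subseteq> edges G \<and>
     (\<forall>v\<in>verts G. distinct (rot G v)) \<and>
     (\<forall>u\<in>verts G. \<forall>v\<in>verts G. u \<noteq> v \<longrightarrow> set (rot G u) \<inter> set (rot G v) = {}) \<and>
     (\<Union>v\<in>verts G. set (rot G v)) = edges G \<times> UNIV"

definition attached :: "('v, 'e) ribbon_graph \<Rightarrow> 'e ribbon_end \<Rightarrow> 'v \<Rightarrow> bool" where
  "attached G d v \<longleftrightarrow> v \<in> verts G \<and> d \<in> set (rot G v)"

definition proper_ribbon :: "('v, 'e) ribbon_graph \<Rightarrow> 'e \<Rightarrow> bool" where
  "proper_ribbon G e \<longleftrightarrow>
     e \<in> edges G \<and> (\<exists>u v. attached G (e, False) u \<and> attached G (e, True) v \<and> u \<noteq> v)"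

definition adjacency :: "('v, 'e) ribbon_graph \<Rightarrow> ('v \<times> 'v) set" where
  "adjacency G =
     {(u, v). \<exists>e\<in>edges G. attached G (e, False) u \<and> attached G (e, True) v}"

definition components :: "('v, 'e) ribbon_graph \<Rightarrow> 'v set set" where
  "components G = verts G // (adjacency G \<union> (adjacency G)\<inverse>)\<^sup>*"

text \<open>
  The boundary of the surface is cut into segments at the corner points of the ribbons.  The
  corner \<open>(d, False)\<close> is the one where the ribbon end \<open>d\<close> starts and \<open>(d, True)\<close> the one where it
  stops, with respect to the reference orientation of its vertex disc.  The segments are the free
  arcs of the vertex discs and the two sides of each ribbon; a side of an untwisted ribbon joins
  a starting corner to a stopping corner, a side of a twisted one joins corners of the same kind.
\<close>

definition vertex_arcs :: "('v, 'e) ribbon_graph \<Rightarrow> (('e ribbon_end \<times> bool) \<times> ('e ribbon_end \<times> bool)) set" where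
  "vertex_arcs G =
     {((rot G v ! i, True), (rot G v ! (Suc i mod length (rot G v)), False)) | v i.
        v \<in> verts G \<and> i < length (rot G v)}"

definition ribbon_sides :: "('v, 'e) ribbon_graph \<Rightarrow> (('e ribbon_end \<times> bool) \<times> ('e ribbon_end \<times> bool)) set" where
  "ribbon_sides G =
     {(((e, False), s), ((e, True), t)) | e s t. e \<in> edges G \<and> (s = t \<longleftrightarrow> e \<in> twisted G)}"

definition boundary_segments :: "('v, 'e) ribbon_graph \<Rightarrow> (('e ribbon_end \<times> bool) \<times> ('e ribbon_end \<times> bool)) set" where
  "boundary_segments G = vertex_arcs G \<union> ribbon_sides G"

definition faces :: "('v, 'e) ribbon_graph \<Rightarrow> ('e ribbon_end \<times> bool) set set" where
  "faces G =
     ((edges G \<times> UNIV) \<times> UNIV) // (boundary_segments G \<union> (boundary_segments G)\<inverse>)\<^sup>*"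

text \<open>
  The boundary circle of an isolated vertex disc contains no corner point and is counted
  separately.
\<close>

definition num_faces :: "('v, 'e) ribbon_graph \<Rightarrow> nat" where
  "num_faces G = card (faces G) + card {v \<in> verts G. rot G v = []}"

definition euler_genus :: "('v, 'e) ribbon_graph \<Rightarrow> int" where
  "euler_genus G =
     2 * int (card (components G)) - int (card (verts G)) + int (card (edges G)) - int (num_faces G)"

text \<open>
  An orientation of the surface orients every vertex disc and every ribbon so that they agree
  along the arcs where they are glued.  The value \<open>True\<close> of \<open>ov v\<close> means that the disc \<open>v\<close> has its
  reference orientation; the reference orientation of a ribbon is the one transported from its
  \<open>False\<close> end, which arrives reversed at the \<open>True\<close> end exactly if the ribbon is twisted.
\<close>

definition orientable :: "('v, 'e) ribbon_graph \<Rightarrow> bool" where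
  "orientable G \<longleftrightarrow>
     (\<exists>(ov :: 'v \<Rightarrow> bool) (oe :: 'e \<Rightarrow> bool). \<forall>e\<in>edges G. \<forall>u v.
        attached G (e, False) u \<longrightarrow> attached G (e, True) v \<longrightarrow>
          oe e = ov u \<and> (oe e = ov v \<longleftrightarrow> e \<notin> twisted G))"

definition partial_petrial :: "('v, 'e) ribbon_graph \<Rightarrow> 'e set \<Rightarrow> ('v, 'e) ribbon_graph" where
  "partial_petrial G A = G\<lparr>twisted := (twisted G - A) \<union> (A - twisted G)\<rparr>"

text \<open>
  The Euler genus of a ribbon graph is nonnegative, so \<open>nat\<close> only adapts the type.
\<close>

definition restricted_orientable_petrial_poly :: "('v, 'e) ribbon_graph \<Rightarrow> int poly" where
  "restricted_orientable_petrial_poly G =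
     (\<Sum>A | A \<subseteq> edges G \<and> orientable (partial_petrial G A).
        monom 1 (nat (euler_genus (partial_petrial G A))))"

text \<open>
  Addition of the ribbons \<open>Inr 0, \<dots>, Inr (n - 1)\<close> parallel to \<open>e\<close>.  At its \<open>False\<close> end, \<open>e\<close> is
  replaced by the sequence of \<open>e\<close> and the new ribbons.  At the \<open>True\<close> end the same sequence appears
  in reverse order if \<open>e\<close> is untwisted and in the same order if \<open>e\<close> is twisted, and the new ribbons
  are twisted iff \<open>e\<close> is, so that consecutive ribbons of the sequence bound a bigon.
\<close>

definition parallel_ends :: "'e \<Rightarrow> nat \<Rightarrow> bool \<Rightarrow> ('e + nat) ribbon_end list" where
  "parallel_ends e n h = (Inl e, h) # map (\<lambda>i. (Inr i, h)) [0..<n]"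

definition replace_end :: "('v, 'e) ribbon_graph \<Rightarrow> 'e \<Rightarrow> nat \<Rightarrow> 'e ribbon_end \<Rightarrow> ('e + nat) ribbon_end list" where
  "replace_end G e n d =
     (if fst d \<noteq> e then [(Inl (fst d), snd d)]
      else if snd d \<and> e \<notin> twisted G then rev (parallel_ends e n (snd d))
      else parallel_ends e n (snd d))"

definition add_parallel :: "('v, 'e) ribbon_graph \<Rightarrow> 'e \<Rightarrow> nat \<Rightarrow> ('v, 'e + nat) ribbon_graph" where
  "add_parallel G e n =
     \<lparr>verts = verts G,
      edges = Inl ` edges G \<union> Inr ` {..<n},
      rot = (\<lambda>v. concat (map (replace_end G e n) (rot G v))),
      twisted = Inl ` twisted G \<union> (if e \<in> twisted G then Inr ` {..<n} else {})\<rparr>"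

definition poly_support :: "int poly \<Rightarrow> nat set" where
  "poly_support f = {i. coeff f i \<noteq> 0}"

definition even_interpolating :: "int poly \<Rightarrow> bool" where
  "even_interpolating f \<longleftrightarrow>
     (\<exists>m m' :: int. poly_support f = {i. even i \<and> m \<le> int i \<and> int i \<le> m'})"

end

theory Submission
  imports Defs
begin

text \<open>
  Write \<open>H\<close> for \<open>G\<close> with \<open>n\<close> ribbons parallel to \<open>e\<close>.  The number of vertices and of components
  of a partial Petrial of \<open>H\<close> is bounded independently of \<open>n\<close>, and its number of ribbons is \<open>n\<close> plus
  a constant.  So up to a bounded error the Euler genus is \<open>n\<close> minus the number of faces.

  In an orientable partial Petrial the twist of a ribbon is determined by the orientations of its
  two end vertices, so \<open>e\<close> and the new ribbons, having the same end vertices, are either all twisted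
  as in \<open>H\<close> or all twisted oppositely.  In the first case the \<open>n\<close> bigons between consecutive
  ribbons of the sequence survive as faces, and the Euler genus stays below a bound independent of
  \<open>n\<close> (\<open>euler_genus_same_twist\<close>).  In the second case a boundary curve that runs through the
  sequence descends from each ribbon to its predecessor until it reaches a ribbon of \<open>G\<close>; the number
  of faces is therefore bounded independently of \<open>n\<close>, and the Euler genus is at least \<open>n\<close> minus a
  constant (\<open>euler_genus_opposite_twist\<close>).

  Both cases occur: the Petrial without twisted ribbons is orientable, and so is the one in which
  exactly the ribbons leaving a fixed end vertex of \<open>e\<close> for another vertex are twisted.  These two
  differ at \<open>e\<close>, because \<open>e\<close> is proper.  For large \<open>n\<close> the support of the polynomial thus has elements
  on both sides of a gap that is long enough to contain an even number.
\<close>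

section \<open>Ribbon graphs and their boundary segments\<close>

lemma attached_unique:
  assumes "is_ribbon_graph G" "attached G d u" "attached G d v"
  shows "u = v"
  using assms unfolding is_ribbon_graph_def attached_def by blast

lemma attached_exists:
  assumes "is_ribbon_graph G" "x \<in> edges G"
  shows "\<exists>v. attached G (x, h) v"
proof -
  have "(x, h) \<in> (\<Union>v\<in>verts G. set (rot G v))"
    using assms unfolding is_ribbon_graph_def by simp
  then show ?thesis unfolding attached_def by blast
qed

lemma vertex_arcsI:
  assumes "v \<in> verts G" "rot G v = xs @ x # y # ys"
  shows "((x, True), (y, False)) \<in> vertex_arcs G"
proof -
  have "rot G v ! length xs = x" "rot G v ! (Suc (length xs) mod length (rot G v)) = y"
    "length xs < length (rot G v)"
    using assms(2) by (simp_all add: nth_append)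
  then show ?thesis unfolding vertex_arcs_def using assms(1) by blast
qed

lemma vertex_arcs_functional:
  assumes G: "is_ribbon_graph G" and ab: "(a, b) \<in> vertex_arcs G" and ac: "(a, c) \<in> vertex_arcs G"
  shows "b = c"
proof -
  obtain v i where v: "v \<in> verts G" "i < length (rot G v)" "a = (rot G v ! i, True)"
    "b = (rot G v ! (Suc i mod length (rot G v)), False)"
    using ab unfolding vertex_arcs_def by blast
  obtain w j where w: "w \<in> verts G" "j < length (rot G w)" "a = (rot G w ! j, True)"
    "c = (rot G w ! (Suc j mod length (rot G w)), False)"
    using ac unfolding vertex_arcs_def by blast
  have "w = v"
    using attached_unique[OF G, of "fst a" w v] v(1,3) w(1,3) nth_mem[OF v(2)] nth_mem[OF w(2)]
    unfolding attached_def by simp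
  moreover have "distinct (rot G v)"
    using G v(1) unfolding is_ribbon_graph_def by blast
  ultimately have "i = j"
    using v w by (simp add: nth_eq_iff_index_eq)
  with \<open>w = v\<close> v w show ?thesis by simp
qed

lemma vertex_arcs_injective:
  assumes G: "is_ribbon_graph G" and ab: "(a, c) \<in> vertex_arcs G" and ac: "(b, c) \<in> vertex_arcs G"
  shows "a = b"
proof -
  obtain v i where v: "v \<in> verts G" "i < length (rot G v)" "a = (rot G v ! i, True)"
    "c = (rot G v ! (Suc i mod length (rot G v)), False)"
    using ab unfolding vertex_arcs_def by blast
  obtain w j where w: "w \<in> verts G" "j < length (rot G w)" "b = (rot G w ! j, True)"
    "c = (rot G w ! (Suc j mod length (rot G w)), False)"
    using ac unfolding vertex_arcs_def by blast
  have l: "Suc i mod length (rot G v) < length (rot G v)"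
    "Suc j mod length (rot G w) < length (rot G w)"
    using v(2) w(2) by (auto intro: mod_less_divisor)
  have "w = v"
    using attached_unique[OF G, of "fst c" w v] v(1,4) w(1,4) nth_mem[OF l(1)] nth_mem[OF l(2)]
    unfolding attached_def by simp
  moreover have "distinct (rot G v)"
    using G v(1) unfolding is_ribbon_graph_def by blast
  ultimately have "Suc i mod length (rot G v) = Suc j mod length (rot G v)"
    using v w l by (simp add: nth_eq_iff_index_eq)
  then have "i = j"
    using v(2) w(2) \<open>w = v\<close> by (auto simp: mod_Suc split: if_splits)
  with \<open>w = v\<close> v w show ?thesis by simp
qed

section \<open>Counting the classes of a generated equivalence relation\<close>

lemma sym_closure_equiv: "equiv UNIV ((r \<union> r\<inverse>)\<^sup>*)"
  by (intro equivI refl_rtrancl sym_rtrancl sym_Un_converse trans_rtrancl) auto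

lemma finite_quotient_closure: "finite S \<Longrightarrow> finite (S // (r \<union> r\<inverse>)\<^sup>*)"
  unfolding quotient_def by simp

lemma card_quotient_closure_le:
  assumes "finite B" and "\<And>x. x \<in> S \<Longrightarrow> \<exists>y\<in>B. (x, y) \<in> (r \<union> r\<inverse>)\<^sup>*"
  shows "card (S // (r \<union> r\<inverse>)\<^sup>*) \<le> card B"
proof -
  let ?R = "(r \<union> r\<inverse>)\<^sup>*"
  have "S // ?R \<subseteq> (\<lambda>y. ?R `` {y}) ` B"
  proof
    fix X assume "X \<in> S // ?R"
    then obtain x where x: "x \<in> S" "X = ?R `` {x}" by (auto elim: quotientE)
    from assms(2)[OF x(1)] obtain y where y: "y \<in> B" "(x, y) \<in> ?R" by blast
    from equiv_class_eq[OF sym_closure_equiv y(2)] x y show "X \<in> (\<lambda>y. ?R `` {y}) ` B" by blast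
  qed
  then show ?thesis
    using assms(1) by (meson card_image_le card_mono finite_imageI le_trans)
qed

text \<open>
  A function that is constant along the generating relation factors through the quotient.
\<close>

lemma card_quotient_closure_ge:
  assumes S: "finite S" and inv: "\<And>x y. (x, y) \<in> r \<Longrightarrow> c x = c y"
  shows "card (c ` S) \<le> card (S // (r \<union> r\<inverse>)\<^sup>*)"
proof -
  let ?R = "(r \<union> r\<inverse>)\<^sup>*"
  have const: "c x = c y" if "(x, y) \<in> ?R" for x y
    using that by (induction rule: rtrancl_induct) (auto dest: inv)
  have "c ` S \<subseteq> (\<lambda>X. the_elem (c ` X)) ` (S // ?R)"
  proof
    fix z assume "z \<in> c ` S"
    then obtain x where x: "x \<in> S" "z = c x" by blast
    have "c ` (?R `` {x}) = {c x}" using const by auto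
    then have "the_elem (c ` (?R `` {x})) = z" using x by simp
    then show "z \<in> (\<lambda>X. the_elem (c ` X)) ` (S // ?R)"
      using quotientI[OF x(1)] by (metis imageI)
  qed
  then show ?thesis
    using finite_quotient_closure[OF S]
    by (meson card_image_le card_mono finite_imageI le_trans)
qed

section \<open>The sequence of parallel ribbons\<close>

definition parallel_ribbon :: "'e \<Rightarrow> nat \<Rightarrow> 'e + nat" where
  "parallel_ribbon e k = (case k of 0 \<Rightarrow> Inl e | Suc i \<Rightarrow> Inr i)"

text \<open>
  The order in which the sequence is met along a vertex disc: at a reversed end of \<open>e\<close> the ribbon
  number \<open>Suc k\<close> comes immediately before the ribbon number \<open>k\<close>.
\<close>

definition reversed_end :: "('v, 'e) ribbon_graph \<Rightarrow> 'e \<Rightarrow> bool \<Rightarrow> bool" where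
  "reversed_end G e h \<longleftrightarrow> h \<and> e \<notin> twisted G"

lemma parallel_ribbon_simps [simp]:
  "parallel_ribbon e 0 = Inl e" "parallel_ribbon e (Suc i) = Inr i"
  by (simp_all add: parallel_ribbon_def)

lemma parallel_ribbon_inject [simp]: "parallel_ribbon e j = parallel_ribbon e k \<longleftrightarrow> j = k"
  by (cases j; cases k) auto

lemma edges_add_parallel: "edges (add_parallel G e n) = Inl ` edges G \<union> Inr ` {..<n}"
  by (simp add: add_parallel_def)

lemma parallel_ribbon_in_edges:
  assumes "e \<in> edges G" "k \<le> n"
  shows "parallel_ribbon e k \<in> edges (add_parallel G e n)"
  using assms by (cases k) (auto simp: edges_add_parallel)

lemma parallel_ends_eq:
  "parallel_ends e n h = map (\<lambda>k. (parallel_ribbon e k, h)) [0..<Suc n]"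
  unfolding parallel_ends_def by (subst upt_conv_Cons) (simp_all add: map_Suc_upt[symmetric] del: upt_Suc)

lemma set_parallel_ends:
  "set (parallel_ends e n h) = (\<lambda>k. (parallel_ribbon e k, h)) ` {..n}"
  unfolding parallel_ends_eq by (auto simp del: upt_Suc)

lemma set_replace_end:
  "set (replace_end G e n (x, h)) =
     (if x = e then (\<lambda>k. (parallel_ribbon e k, h)) ` {..n} else {(Inl x, h)})"
  by (simp add: replace_end_def set_parallel_ends)

lemma distinct_replace_end: "distinct (replace_end G e n d)"
proof -
  have "distinct (parallel_ends e n h)" for h
    unfolding parallel_ends_eq by (simp add: distinct_map inj_on_def del: upt_Suc)
  then show ?thesis by (simp add: replace_end_def)
qed

text \<open>
  The end of \<open>G\<close> whose replacement contains a given ribbon end.  As this is a function, the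
  replacements of different ends are disjoint, and attachment in the enlarged ribbon graph reduces
  to attachment in \<open>G\<close>.
\<close>

definition original_end :: "'e \<Rightarrow> ('e + nat) ribbon_end \<Rightarrow> 'e ribbon_end" where
  "original_end e d = (case fst d of Inl x \<Rightarrow> x | Inr i \<Rightarrow> e, snd d)"

lemma original_end_parallel [simp]: "original_end e (parallel_ribbon e k, h) = (e, h)"
  by (cases k) (auto simp: original_end_def)

lemma original_end_replace_end:
  "c \<in> set (replace_end G e n d) \<Longrightarrow> original_end e c = d"
  by (cases d) (auto simp: set_replace_end original_end_def[of _ "(Inl _, _)"] split: if_splits)

lemma mem_replace_end:
  "c \<in> set (replace_end G e n d) \<longleftrightarrow>
     original_end e c = d \<and> fst c \<in> range Inl \<union> Inr ` {..<n}"
proof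
  assume c: "c \<in> set (replace_end G e n d)"
  obtain x h where d: "d = (x, h)" by fastforce
  have "parallel_ribbon e k \<in> range Inl \<union> Inr ` {..<n}" if "k \<le> n" for k
    using that by (cases k) auto
  moreover have "fst c = Inl x \<or> (\<exists>k\<le>n. fst c = parallel_ribbon e k)"
    using c d by (auto simp: set_replace_end split: if_splits)
  ultimately have "fst c \<in> range Inl \<union> Inr ` {..<n}" by (metis UnI1 rangeI)
  with original_end_replace_end[OF c]
  show "original_end e c = d \<and> fst c \<in> range Inl \<union> Inr ` {..<n}" by simp
next
  assume c: "original_end e c = d \<and> fst c \<in> range Inl \<union> Inr ` {..<n}"
  obtain y h where y: "c = (y, h)" by fastforce
  show "c \<in> set (replace_end G e n d)"
  proof (cases y)
    case (Inl x)
    then show ?thesis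
      using c y by (auto simp: original_end_def set_replace_end image_iff intro!: bexI[of _ 0])
  next
    case (Inr i)
    then have "Suc i \<le> n" using c y by auto
    with Inr c y show ?thesis
      by (auto simp: original_end_def set_replace_end image_iff intro!: bexI[of _ "Suc i"])
  qed
qed

lemma attached_add_parallel:
  "attached (add_parallel G e n) c v \<longleftrightarrow>
     attached G (original_end e c) v \<and> fst c \<in> range Inl \<union> Inr ` {..<n}"
  by (auto simp: attached_def add_parallel_def mem_replace_end)

lemma distinct_concat_map:
  assumes "distinct xs" "\<And>x. x \<in> set xs \<Longrightarrow> distinct (f x)"
    and "\<And>x y. x \<in> set xs \<Longrightarrow> y \<in> set xs \<Longrightarrow> x \<noteq> y \<Longrightarrow> set (f x) \<inter> set (f y) = {}"
  shows "distinct (concat (map f xs))"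
  using assms by (induction xs) fastforce+

lemma is_ribbon_graph_add_parallel:
  fixes G :: "('v, 'e) ribbon_graph"
  assumes G: "is_ribbon_graph G" and e: "e \<in> edges G"
  shows "is_ribbon_graph (add_parallel G e n)"
proof -
  let ?H = "add_parallel G e n"
  have verts: "verts ?H = verts G" by (simp add: add_parallel_def)
  have "finite (verts ?H)" "finite (edges ?H)" "twisted ?H \<subseteq> edges ?H"
    using G by (auto simp: is_ribbon_graph_def add_parallel_def)
  moreover have "distinct (rot ?H v)" if "v \<in> verts ?H" for v
  proof -
    have "distinct (rot G v)" using G that by (simp add: is_ribbon_graph_def verts)
    then show ?thesis
      by (auto simp: add_parallel_def mem_replace_end intro!: distinct_concat_map distinct_replace_end)
  qed
  moreover have "set (rot ?H u) \<inter> set (rot ?H v) = {}"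
    if uv: "u \<in> verts ?H" "v \<in> verts ?H" "u \<noteq> v" for u v
  proof (rule ccontr)
    assume "set (rot ?H u) \<inter> set (rot ?H v) \<noteq> {}"
    then obtain c where "attached ?H c u" "attached ?H c v"
      using uv unfolding attached_def by blast
    with attached_unique[OF G, of "original_end e c" u v] uv(3) show False
      by (auto simp: attached_add_parallel)
  qed
  moreover have "(\<Union>v\<in>verts ?H. set (rot ?H v)) = edges ?H \<times> UNIV"
  proof (rule set_eqI)
    fix c :: "('e + nat) ribbon_end"
    have "c \<in> (\<Union>v\<in>verts ?H. set (rot ?H v)) \<longleftrightarrow> (\<exists>v. attached ?H c v)"
      unfolding attached_def by blast
    also have "\<dots> \<longleftrightarrow> original_end e c \<in> (\<Union>v\<in>verts G. set (rot G v)) \<and>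
        fst c \<in> range Inl \<union> Inr ` {..<n}"
      by (auto simp: attached_add_parallel) (auto simp: attached_def)
    also have "\<dots> \<longleftrightarrow> original_end e c \<in> edges G \<times> UNIV \<and> fst c \<in> range Inl \<union> Inr ` {..<n}"
      using G unfolding is_ribbon_graph_def by simp
    also have "\<dots> \<longleftrightarrow> c \<in> edges ?H \<times> UNIV"
      using e by (cases c; cases "fst c") (auto simp: original_end_def edges_add_parallel)
    finally show "c \<in> (\<Union>v\<in>verts ?H. set (rot ?H v)) \<longleftrightarrow> c \<in> edges ?H \<times> UNIV" .
  qed
  ultimately show ?thesis unfolding is_ribbon_graph_def by blast
qed

text \<open>
  The two free arcs of the bigon between the ribbons number \<open>k\<close> and \<open>Suc k\<close>, one at each end \<open>h\<close>.
\<close>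

lemma arc_between_parallel:
  assumes G: "is_ribbon_graph G" and e: "e \<in> edges G" and k: "k < n"
  defines "P \<equiv> \<lambda>k h. (parallel_ribbon e k, h)"
  shows "\<not> reversed_end G e h \<Longrightarrow>
           ((P k h, True), (P (Suc k) h, False)) \<in> vertex_arcs (add_parallel G e n)"
    and "reversed_end G e h \<Longrightarrow>
           ((P (Suc k) h, True), (P k h, False)) \<in> vertex_arcs (add_parallel G e n)"
proof -
  let ?H = "add_parallel G e n"
  obtain v where v: "attached G (e, h) v" using attached_exists[OF G e] by blast
  then obtain ys zs where split: "rot G v = ys @ (e, h) # zs"
    unfolding attached_def by (meson split_list)
  have vH: "v \<in> verts ?H" using v by (simp add: attached_def add_parallel_def)
  have rot: "rot ?H v = concat (map (replace_end G e n) ys) @ replace_end G e n (e, h) @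
      concat (map (replace_end G e n) zs)"
    by (simp add: add_parallel_def split)
  have upt: "[0..<Suc n] = [0..<k] @ k # Suc k # [Suc (Suc k)..<Suc n]"
    using k upt_add_eq_append[of 0 k "Suc n - k"] by (simp add: upt_conv_Cons del: upt_Suc)
  have ends: "parallel_ends e n h =
      map (\<lambda>k. P k h) [0..<k] @ P k h # P (Suc k) h # map (\<lambda>k. P k h) [Suc (Suc k)..<Suc n]"
    unfolding parallel_ends_eq upt P_def by simp
  show "((P k h, True), (P (Suc k) h, False)) \<in> vertex_arcs ?H" if "\<not> reversed_end G e h"
  proof -
    have "replace_end G e n (e, h) = parallel_ends e n h"
      using that by (auto simp: replace_end_def reversed_end_def)
    then show ?thesis
      using rot by (auto simp: ends simp del: upt_Suc intro!: vertex_arcsI[OF vH, of "_ @ _"])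
  qed
  show "((P (Suc k) h, True), (P k h, False)) \<in> vertex_arcs ?H" if "reversed_end G e h"
  proof -
    have "replace_end G e n (e, h) = rev (parallel_ends e n h)"
      using that by (auto simp: replace_end_def reversed_end_def)
    then show ?thesis
      using rot by (auto simp: ends simp del: upt_Suc intro!: vertex_arcsI[OF vH, of "_ @ _"])
  qed
qed

section \<open>Twisting a ribbon graph arbitrarily\<close>

lemma vertex_arcs_twisted_update [simp]: "vertex_arcs (H\<lparr>twisted := T\<rparr>) = vertex_arcs H"
  by (simp add: vertex_arcs_def)

lemma attached_twisted_update [simp]: "attached (H\<lparr>twisted := T\<rparr>) = attached H"
  by (simp add: attached_def fun_eq_iff)

text \<open>
  Every cut of the underlying graph gives an orientable twisting: turning over the vertex discs on
  one side of the cut makes all ribbons untwisted.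
\<close>

lemma orientable_cut:
  fixes side :: "'v \<Rightarrow> bool"
  assumes G: "is_ribbon_graph G"
    and T: "T = {x \<in> edges G. \<exists>u v. attached G (x, False) u \<and> attached G (x, True) v \<and> side u \<noteq> side v}"
  shows "orientable (G\<lparr>twisted := T\<rparr>)"
proof -
  define oe where "oe x = side (THE u. attached G (x, False) u)" for x
  have "oe x = side u \<and> (oe x = side v \<longleftrightarrow> x \<notin> T)"
    if x: "x \<in> edges G" "attached G (x, False) u" "attached G (x, True) v" for x u v
  proof -
    have "(THE u. attached G (x, False) u) = u"
      using x attached_unique[OF G] by blast
    moreover have "x \<in> T \<longleftrightarrow> side u \<noteq> side v"
      using x attached_unique[OF G] unfolding T by blast
    ultimately show ?thesis by (auto simp: oe_def)
  qed
  then show ?thesis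
    unfolding orientable_def by (auto intro!: exI[of _ side] exI[of _ oe])
qed

text \<open>
  Given an orientation of the surface, a ribbon between different vertices is twisted iff exactly
  one of its end vertices has its reference orientation, and no loop is twisted.  So the twist of a
  ribbon depends only on its end vertices.
\<close>

lemma orientable_parallel_same_twist:
  assumes "orientable G" "x \<in> edges G" "y \<in> edges G"
    and "attached G (x, False) u" "attached G (x, True) v"
    and "attached G (y, False) u" "attached G (y, True) v"
  shows "x \<in> twisted G \<longleftrightarrow> y \<in> twisted G"
  using assms unfolding orientable_def by metis

section \<open>Faces and Euler genus\<close>

text \<open>
  The corner with \<open>s \<noteq> reversed_end G e h\<close> of the ribbon number \<open>k\<close> faces the ribbon number
  \<open>Suc k\<close>, the other one its predecessor.  So the following assigns to a corner the number of the
  bigon it lies on, and \<open>None\<close> to the corners outside all bigons.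
\<close>

definition bigon_number ::
  "('v, 'e) ribbon_graph \<Rightarrow> 'e \<Rightarrow> nat \<Rightarrow> ('e + nat) ribbon_end \<times> bool \<Rightarrow> nat option" where
  "bigon_number G e n c = (case c of ((x, h), s) \<Rightarrow>
     if \<exists>k<n. x = parallel_ribbon e k \<and> s \<noteq> reversed_end G e h
     then Some (THE k. x = parallel_ribbon e k)
     else if \<exists>k<n. x = parallel_ribbon e (Suc k) \<and> s = reversed_end G e h
     then Some (THE k. x = parallel_ribbon e (Suc k))
     else None)"

lemma bigon_number_eq_Some:
  "bigon_number G e n ((x, h), s) = Some k \<longleftrightarrow>
     k < n \<and> x = parallel_ribbon e (if s \<noteq> reversed_end G e h then k else Suc k)"
  by (auto simp: bigon_number_def simp del: parallel_ribbon_simps)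

lemma finite_corners:
  "is_ribbon_graph G \<Longrightarrow> finite ((edges G \<times> (UNIV :: bool set)) \<times> (UNIV :: bool set))"
  by (simp add: is_ribbon_graph_def)

lemma bigon_number_vertex_arcs:
  assumes G: "is_ribbon_graph G" and e: "e \<in> edges G"
    and ab: "(a, b) \<in> vertex_arcs (add_parallel G e n)"
  shows "bigon_number G e n a = bigon_number G e n b"
proof -
  let ?H = "add_parallel G e n"
  let ?c = "bigon_number G e n"
  note H = is_ribbon_graph_add_parallel[OF G e, of n]
  obtain x h y h' where a: "a = ((x, h), True)" and b: "b = ((y, h'), False)"
  proof -
    have "snd a" "\<not> snd b" using ab by (auto simp: vertex_arcs_def)
    then show thesis using that by (metis (full_types) prod.collapse)
  qed
  \<comment> \<open>An arc starting in a bigon is known, and so is one ending in a bigon, as arcs are determined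
    by either of their end points.\<close>
  have 1: "?c b = Some k" if "?c a = Some k" for k
  proof (cases "reversed_end G e h")
    case False
    with that a have k: "k < n" "x = parallel_ribbon e k"
      by (auto simp: bigon_number_eq_Some)
    with vertex_arcs_functional[OF H ab] arc_between_parallel(1)[OF G e k(1) False] a
    have "b = ((parallel_ribbon e (Suc k), h), False)" by simp
    with False k show ?thesis by (simp only: bigon_number_eq_Some) simp
  next
    case True
    with that a have k: "k < n" "x = parallel_ribbon e (Suc k)"
      by (auto simp: bigon_number_eq_Some)
    with vertex_arcs_functional[OF H ab] arc_between_parallel(2)[OF G e k(1) True] a
    have "b = ((parallel_ribbon e k, h), False)" by simp
    with True k show ?thesis by (simp only: bigon_number_eq_Some) simp
  qed
  have 2: "?c a = Some k" if "?c b = Some k" for k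
  proof (cases "reversed_end G e h'")
    case False
    with that b have k: "k < n" "y = parallel_ribbon e (Suc k)"
      by (auto simp: bigon_number_eq_Some)
    with vertex_arcs_injective[OF H ab] arc_between_parallel(1)[OF G e k(1) False] b
    have "a = ((parallel_ribbon e k, h'), True)" by simp
    with False k show ?thesis by (simp only: bigon_number_eq_Some) simp
  next
    case True
    with that b have k: "k < n" "y = parallel_ribbon e k"
      by (auto simp: bigon_number_eq_Some)
    with vertex_arcs_injective[OF H ab] arc_between_parallel(2)[OF G e k(1) True] b
    have "a = ((parallel_ribbon e (Suc k), h'), True)" by simp
    with True k show ?thesis by (simp only: bigon_number_eq_Some) simp
  qed
  show ?thesis using 1 2 by (metis option.exhaust)
qed

text \<open>
  If the sequence is twisted as in \<open>G\<close>, a ribbon side joins two corners on the same side of the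
  ribbon in the sequence.  The bigon number is then constant along all boundary segments, so the
  \<open>n\<close> bigons are distinct faces.
\<close>

lemma card_faces_same_twist:
  assumes G: "is_ribbon_graph G" and e: "e \<in> edges G"
    and T: "\<And>k. k \<le> n \<Longrightarrow> parallel_ribbon e k \<in> T \<longleftrightarrow> e \<in> twisted G"
  shows "n \<le> card (faces ((add_parallel G e n)\<lparr>twisted := T\<rparr>))"
proof -
  let ?H = "add_parallel G e n"
  let ?K = "?H\<lparr>twisted := T\<rparr>"
  let ?c = "bigon_number G e n"
  let ?S = "(edges ?K \<times> (UNIV :: bool set)) \<times> (UNIV :: bool set)"
  note H = is_ribbon_graph_add_parallel[OF G e, of n]
  have sides: "?c a = ?c b" if "(a, b) \<in> ribbon_sides ?K" for a b
  proof -
    from that obtain x s t where ab: "a = ((x, False), s)" "b = ((x, True), t)" "s = t \<longleftrightarrow> x \<in> T"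
      unfolding ribbon_sides_def by auto
    have "?c a = Some k \<longleftrightarrow> ?c b = Some k" for k
      using T[of k] T[of "Suc k"] ab
      by (auto simp: bigon_number_eq_Some reversed_end_def simp del: parallel_ribbon_simps)
    then show ?thesis by (metis option.exhaust)
  qed
  have "?c a = ?c b" if "(a, b) \<in> boundary_segments ?K" for a b
    using that sides[of a b] bigon_number_vertex_arcs[OF G e, of a b n]
    unfolding boundary_segments_def by (simp only: Un_iff vertex_arcs_twisted_update) blast
  then have le: "card (?c ` ?S) \<le> card (faces ?K)"
    unfolding faces_def
    by (intro card_quotient_closure_ge) (use finite_corners[OF H] in auto)
  have "Some ` {..<n} \<subseteq> ?c ` ?S"
  proof clarify
    fix k assume k: "k < n"
    have "?c ((parallel_ribbon e k, False), True) = Some k"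
      using k by (simp add: bigon_number_eq_Some reversed_end_def)
    moreover have "((parallel_ribbon e k, False), True) \<in> ?S"
      using parallel_ribbon_in_edges[OF e, of k n] k by simp
    ultimately show "Some k \<in> ?c ` ?S" by (metis imageI)
  qed
  then have "card (Some ` {..<n}) \<le> card (?c ` ?S)"
    using finite_corners[OF H] by (intro card_mono) auto
  with le show ?thesis by (simp add: card_image)
qed

text \<open>
  If the sequence is twisted oppositely, every ribbon side joins a corner facing the successor to
  a corner facing the predecessor.  A boundary curve thus leads from any corner of a ribbon of the
  sequence to a corner of its predecessor, possibly after traversing one ribbon side, and finally
  to a corner of \<open>e\<close>.
\<close>

lemma card_faces_opposite_twist:
  fixes G :: "('v, 'e) ribbon_graph"
  assumes G: "is_ribbon_graph G" and e: "e \<in> edges G"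
    and T: "\<And>k. k \<le> n \<Longrightarrow> parallel_ribbon e k \<in> T \<longleftrightarrow> e \<notin> twisted G"
  shows "card (faces ((add_parallel G e n)\<lparr>twisted := T\<rparr>)) \<le> 4 * card (edges G)"
proof -
  let ?H = "add_parallel G e n"
  let ?K = "?H\<lparr>twisted := T\<rparr>"
  let ?R = "(boundary_segments ?K \<union> (boundary_segments ?K)\<inverse>)\<^sup>*"
  let ?B = "((Inl ` edges G :: ('e + nat) set) \<times> (UNIV :: bool set)) \<times> (UNIV :: bool set)"
  let ?P = "parallel_ribbon e"
  have facing_pred: "(((?P (Suc k), h), reversed_end G e h), ((?P k, h), \<not> reversed_end G e h)) \<in> ?R"
    if "k < n" for k h
    using arc_between_parallel[OF G e that, of h]
    by (cases "reversed_end G e h") (auto simp: boundary_segments_def)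
  have across: "(((?P k, h), \<not> reversed_end G e h), ((?P k, \<not> h), reversed_end G e (\<not> h))) \<in> ?R"
    if "k \<le> n" for k h
  proof -
    have "(((?P k, False), s), ((?P k, True), t)) \<in> boundary_segments ?K"
      if "s = t \<longleftrightarrow> e \<notin> twisted G" for s t
      using that T[OF \<open>k \<le> n\<close>] parallel_ribbon_in_edges[OF e \<open>k \<le> n\<close>]
      by (auto simp: boundary_segments_def ribbon_sides_def)
    then show ?thesis by (cases h) (auto simp: reversed_end_def)
  qed
  have descend: "\<exists>y\<in>?B. (((?P k, h), s), y) \<in> ?R" if "k \<le> n" for k h s
    using that
  proof (induction k arbitrary: h s)
    case 0
    have "((?P 0, h), s) \<in> ?B" using e by simp
    then show ?case by blast
  next
    case (Suc k)
    have "\<exists>h' s'. (((?P (Suc k), h), s), ((?P k, h'), s')) \<in> ?R"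
    proof (cases "s = reversed_end G e h")
      case True
      then show ?thesis using facing_pred[of k h] Suc.prems by auto
    next
      case False
      then have "s = (\<not> reversed_end G e h)" by auto
      then show ?thesis
        using across[of "Suc k" h] facing_pred[of k "\<not> h"] Suc.prems
        by (meson Suc_le_eq rtrancl_trans)
    qed
    with Suc.IH Suc.prems show ?case by (meson Suc_leD rtrancl_trans)
  qed
  have fin: "finite ?B" using G by (simp add: is_ribbon_graph_def)
  have "card (faces ?K) \<le> card ?B"
    unfolding faces_def
  proof (rule card_quotient_closure_le[OF fin])
    fix c :: "('e + nat) ribbon_end \<times> bool"
    assume "c \<in> (edges ?K \<times> UNIV) \<times> UNIV"
    then obtain x h s where c: "c = ((x, h), s)" and x: "x \<in> edges ?H" by auto
    show "\<exists>y\<in>?B. (c, y) \<in> ?R"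
    proof (cases x)
      case (Inl z)
      then have "c \<in> ?B" using c x by (auto simp: edges_add_parallel)
      then show ?thesis by blast
    next
      case (Inr i)
      then have "i < n" using x by (auto simp: edges_add_parallel)
      with descend[of "Suc i"] Inr c show ?thesis by simp
    qed
  qed
  also have "card ?B = 4 * card (edges G)"
    by (simp add: card_cartesian_product card_image)
  finally show ?thesis .
qed

lemma card_edges_add_parallel:
  assumes "is_ribbon_graph G"
  shows "card (edges (add_parallel G e n)) = card (edges G) + n"
proof -
  have "card (Inl ` edges G \<union> Inr ` {..<n}) =
      card (Inl ` edges G :: ('b + nat) set) + card (Inr ` {..<n} :: ('b + nat) set)"
    using assms by (intro card_Un_disjoint) (auto simp: is_ribbon_graph_def)
  then show ?thesis by (simp add: edges_add_parallel card_image)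
qed

lemma card_components_add_parallel_le:
  assumes "is_ribbon_graph G"
  shows "card (components ((add_parallel G e n)\<lparr>twisted := T\<rparr>)) \<le> card (verts G)"
proof -
  have "card (components ((add_parallel G e n)\<lparr>twisted := T\<rparr>))
      \<le> card (verts ((add_parallel G e n)\<lparr>twisted := T\<rparr>))"
    unfolding components_def
    using assms by (intro card_quotient_closure_le) (auto simp: is_ribbon_graph_def add_parallel_def)
  then show ?thesis by (simp add: add_parallel_def)
qed

lemma euler_genus_same_twist:
  assumes G: "is_ribbon_graph G" and e: "e \<in> edges G"
    and T: "\<And>k. k \<le> n \<Longrightarrow> parallel_ribbon e k \<in> T \<longleftrightarrow> e \<in> twisted G"
  shows "euler_genus ((add_parallel G e n)\<lparr>twisted := T\<rparr>) \<le> int (card (verts G) + card (edges G))"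
proof -
  have "n \<le> card (faces ((add_parallel G e n)\<lparr>twisted := T\<rparr>))"
    by (rule card_faces_same_twist[OF G e T])
  then show ?thesis
    using card_components_add_parallel_le[OF G, where e = e and n = n and T = T]
      card_edges_add_parallel[OF G, of e n]
    by (simp add: euler_genus_def num_faces_def) (simp add: add_parallel_def)
qed

lemma euler_genus_opposite_twist:
  assumes G: "is_ribbon_graph G" and e: "e \<in> edges G"
    and T: "\<And>k. k \<le> n \<Longrightarrow> parallel_ribbon e k \<in> T \<longleftrightarrow> e \<notin> twisted G"
  shows "euler_genus ((add_parallel G e n)\<lparr>twisted := T\<rparr>)
           \<ge> int n - int (3 * card (edges G) + 2 * card (verts G))"
proof -
  let ?K = "(add_parallel G e n)\<lparr>twisted := T\<rparr>"
  have "card {v \<in> verts ?K. rot ?K v = []} \<le> card (verts ?K)"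
    using G by (intro card_mono) (auto simp: is_ribbon_graph_def add_parallel_def)
  moreover have "card (faces ?K) \<le> 4 * card (edges G)"
    by (rule card_faces_opposite_twist[OF G e T])
  ultimately have "num_faces ?K \<le> 4 * card (edges G) + card (verts G)"
    by (simp add: num_faces_def) (simp add: add_parallel_def)
  then show ?thesis
    using card_edges_add_parallel[OF G, of e n]
    by (simp add: euler_genus_def) (simp add: add_parallel_def)
qed

section \<open>The support of the polynomial\<close>

text \<open>
  All monomials have coefficient one, so nothing cancels.
\<close>

lemma poly_support_sum_monom:
  assumes "finite F"
  shows "poly_support (\<Sum>A\<in>F. monom 1 (g A)) = g ` F"
proof -
  have "coeff (\<Sum>A\<in>F. monom 1 (g A)) i = int (card {A \<in> F. g A = i})" for i
  proof -
    have "coeff (\<Sum>A\<in>F. monom 1 (g A)) i = (\<Sum>A\<in>F. if g A = i then 1 else (0 :: int))"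
      by (simp add: coeff_sum)
    also have "\<dots> = (\<Sum>A\<in>{A \<in> F. g A = i}. 1)"
      by (rule sum.inter_filter[OF assms, symmetric])
    finally show ?thesis by simp
  qed
  then show ?thesis
    using assms by (auto simp: poly_support_def)
qed

text \<open>
  Taking the symmetric difference with \<open>twisted G\<close> is an involution on the sets of ribbons.  So
  the partial Petrials can be indexed by their sets of twisted ribbons instead of the sets of
  ribbons that receive a half-twist.
\<close>

lemma poly_support_restricted_orientable_petrial_poly:
  assumes G: "is_ribbon_graph G"
  shows "poly_support (restricted_orientable_petrial_poly G) =
    {nat (euler_genus (G\<lparr>twisted := T\<rparr>)) | T. T \<subseteq> edges G \<and> orientable (G\<lparr>twisted := T\<rparr>)}"
proof -
  let ?F = "{A. A \<subseteq> edges G \<and> orientable (partial_petrial G A)}"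
  have fin: "finite ?F" using G by (simp add: is_ribbon_graph_def)
  have "poly_support (restricted_orientable_petrial_poly G) =
      (\<lambda>A. nat (euler_genus (partial_petrial G A))) ` ?F"
    unfolding restricted_orientable_petrial_poly_def by (rule poly_support_sum_monom[OF fin])
  also have "\<dots> = (\<lambda>T. nat (euler_genus (G\<lparr>twisted := T\<rparr>))) `
      {T. T \<subseteq> edges G \<and> orientable (G\<lparr>twisted := T\<rparr>)}" (is "_ = ?g ` ?T")
  proof -
    define flip where "flip A = (twisted G - A) \<union> (A - twisted G)" for A
    have petrial: "partial_petrial G A = G\<lparr>twisted := flip A\<rparr>" for A
      by (simp add: partial_petrial_def flip_def)
    have flip: "flip (flip A) = A" "flip A \<subseteq> edges G \<longleftrightarrow> A \<subseteq> edges G" for A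
      using G by (auto simp: flip_def is_ribbon_graph_def)
    have "?T = flip ` ?F"
    proof (intro set_eqI iffI)
      fix T assume "T \<in> ?T"
      then have "flip T \<in> ?F" by (simp add: petrial flip)
      then show "T \<in> flip ` ?F" using flip(1) by (metis imageI)
    next
      fix T assume "T \<in> flip ` ?F"
      then obtain A where "T = flip A" "A \<in> ?F" by blast
      then show "T \<in> ?T" by (simp add: petrial flip(2))
    qed
    then show ?thesis by (simp only: image_image petrial)
  qed
  finally show ?thesis by (auto simp: image_iff)
qed

lemma even_interpolating_between:
  assumes "even_interpolating f" "a \<in> poly_support f" "b \<in> poly_support f" "a \<le> i" "i \<le> b" "even i"
  shows "i \<in> poly_support f"
  using assms unfolding even_interpolating_def by fastforce

theorem theorem4p3:
  fixes G :: "('v, 'e) ribbon_graph" and e :: 'e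
  assumes "is_ribbon_graph G" and "proper_ribbon G e"
  shows "\<exists>N. \<forall>n\<ge>N. even n \<longrightarrow>
    \<not> even_interpolating (restricted_orientable_petrial_poly (add_parallel G e n))"
proof -
  note G = assms(1)
  obtain u v where e: "e \<in> edges G" and uv: "attached G (e, False) u" "attached G (e, True) v" "u \<noteq> v"
    using assms(2) unfolding proper_ribbon_def by blast
  \<comment> \<open>\<open>L\<close> bounds the Euler genera in the first case, and \<open>N\<close> makes those in the second case at least
    \<open>L + 3\<close>: the two numbers in between have different parity.\<close>
  define L where "L = card (verts G) + card (edges G)"
  define N where "N = L + 3 + 3 * card (edges G) + 2 * card (verts G)"
  have "\<not> even_interpolating (restricted_orientable_petrial_poly (add_parallel G e n))"
    if n: "n \<ge> N" for n
  proof
    define H where "H = add_parallel G e n"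
    have H: "is_ribbon_graph H" unfolding H_def by (rule is_ribbon_graph_add_parallel[OF G e])
    define S where "S = poly_support (restricted_orientable_petrial_poly H)"
    have S: "S = {nat (euler_genus (H\<lparr>twisted := T\<rparr>)) | T. T \<subseteq> edges H \<and> orientable (H\<lparr>twisted := T\<rparr>)}"
      unfolding S_def by (rule poly_support_restricted_orientable_petrial_poly[OF H])
    have ends: "attached H (parallel_ribbon e k, False) u" "attached H (parallel_ribbon e k, True) v"
      if "k \<le> n" for k
      using uv that by (cases k; auto simp: H_def attached_add_parallel original_end_def)+
    have par: "parallel_ribbon e k \<in> edges H" if "k \<le> n" for k
      unfolding H_def by (rule parallel_ribbon_in_edges[OF e that])
    have uniform: "parallel_ribbon e k \<in> T \<longleftrightarrow> Inl e \<in> T"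
      if "orientable (H\<lparr>twisted := T\<rparr>)" "k \<le> n" for T k
      using orientable_parallel_same_twist[OF that(1), of "parallel_ribbon e k" "parallel_ribbon e 0" u v]
        that(2) ends[of k] ends[of 0] par[of k] par[of 0] by simp
    have low: "nat (euler_genus (H\<lparr>twisted := T\<rparr>)) \<le> L"
      if "orientable (H\<lparr>twisted := T\<rparr>)" "Inl e \<in> T \<longleftrightarrow> e \<in> twisted G" for T
      using euler_genus_same_twist[OF G e, of n T] uniform[OF that(1)] that(2)
      by (simp add: H_def L_def)
    have high: "nat (euler_genus (H\<lparr>twisted := T\<rparr>)) \<ge> L + 3"
      if "orientable (H\<lparr>twisted := T\<rparr>)" "Inl e \<in> T \<longleftrightarrow> e \<notin> twisted G" for T
      using euler_genus_opposite_twist[OF G e, of n T] uniform[OF that(1)] that(2) n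
      by (simp add: H_def N_def)
    have gap: "i \<le> L \<or> i \<ge> L + 3" if "i \<in> S" for i
      using that low high unfolding S by blast
    define cut where "cut side = {x \<in> edges H. \<exists>u v. attached H (x, False) u \<and> attached H (x, True) v \<and>
      side u \<noteq> side v}" for side :: "'v \<Rightarrow> bool"
    have cut: "cut side \<subseteq> edges H" "orientable (H\<lparr>twisted := cut side\<rparr>)" for side
      by (auto simp: cut_def orientable_cut[OF H])
    \<comment> \<open>The trivial cut and the cut around \<open>v\<close> realise the two possible twists of \<open>e\<close>; which of them
      agrees with \<open>G\<close> depends on whether \<open>e\<close> is twisted there.\<close>
    have "Inl e \<notin> cut (\<lambda>w. True)" "Inl e \<in> cut (\<lambda>w. w = v)"
      using ends[of 0] par[of 0] uv(3) by (auto simp: cut_def)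
    then obtain T1 T2 where T1: "T1 \<subseteq> edges H" "orientable (H\<lparr>twisted := T1\<rparr>)" "Inl e \<in> T1 \<longleftrightarrow> e \<in> twisted G"
      and T2: "T2 \<subseteq> edges H" "orientable (H\<lparr>twisted := T2\<rparr>)" "Inl e \<in> T2 \<longleftrightarrow> e \<notin> twisted G"
      using cut by metis
    obtain a where a: "a \<in> S" "a \<le> L" using low[OF T1(2,3)] T1 unfolding S by blast
    obtain b where b: "b \<in> S" "b \<ge> L + 3" using high[OF T2(2,3)] T2 unfolding S by blast
    define i where "i = (if even L then L + 2 else L + 1)"
    have i: "even i" "L < i" "i < L + 3" by (auto simp: i_def)
    assume "even_interpolating (restricted_orientable_petrial_poly (add_parallel G e n))"
    then have "i \<in> S"
      using even_interpolating_between[of _ a b i] a b i unfolding S_def H_def by simp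
    with gap i show False by force
  qed
  then show ?thesis by blast
qed

end
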